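(* Let $\mathsf{H},\mathsf{r},\mathsf{N}$ be positive integers with $\mathsf{r}\le\mathsf{H}$, and let $\mathsf{K}_i=\binom{\mathsf{H}-i}{\mathsf{r}-i}$ for integers $i\ge 0$. For each integer $g$ with $1\le g\le\mathsf{K}_1$ define $$\mathsf{M}_{1}(g)=\mathsf{N}\,\frac{\sum_{a=1}^{\mathsf{r}}\binom{\mathsf{r}}{a}\binom{\mathsf{K}_a-1}{g-2}(-1)^{a-1}}{\sum_{a=1}^{\mathsf{r}}\binom{\mathsf{r}}{a}\binom{\mathsf{K}_a}{g-1}(-1)^{a-1}},\qquad \mathsf{M}_{2}(g)=\mathsf{N}\,\frac{g-1}{\mathsf{K}_1}.$$ Then for every integer $g$ with $1\le g\le\mathsf{K}_1$ we have $\mathsf{M}_1(g)\le\mathsf{M}_2(g)$, with equality if and only if $g\ge\mathsf{K}_2+2$.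
   Context: Convention: $\binom{x}{y}=0$ if $x<0$ or $y<0$ or $x<y$. Interpretation: in an $(\mathsf{H},\mathsf{r},\mathsf{M},\mathsf{N})$ combination network, a server with $\mathsf{N}$ files communicates with $\mathsf{K}_0=\binom{\mathsf{H}}{\mathsf{r}}$ users, each with a cache of size $\mathsf{M}$ files, through $\mathsf{H}$ relays; the users are in bijection with the $\mathsf{r}$-element subsets of the relays, each user being connected to the relays of its subset. Here $\mathsf{K}_i$ (for $0\le i\le\mathsf{r}$) is the number of users simultaneously connected to $i$ given relays. A scheme attains a coded caching gain of $g$ if its max-link load (the largest load, normalized by the file size, over all server-to-relay and relay-to-user links, for worst-case demands) equals $\frac{1}{g}\cdot\frac{\mathsf{K}_0(1-\mathsf{M}/\mathsf{N})}{\mathsf{H}}$. The quantities $\mathsf{M}_1(g)$ and $\mathsf{M}_2(g)$ are the cache sizes (in files) required by two different caching schemes to attain a coded caching gain of $g$: $\mathsf{M}_1(g)$ for the asymmetric coded placement scheme, and $\mathsf{M}_2(g)$ for the earlier MDS-based scheme of Zewail and Yener.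
   Formalization: The equality criterion is proved as "g = 1 or g ≥ K_2+2": at g = 1 the convention gives M_1(1) = M_2(1) = 0, so equality holds there although 1 ≥ K_2+2 fails. For g ≥ 2 the criterion is exactly as stated. *)

theory Defs
  imports Complex_Main
begin

(* The binomial coefficient on integer arguments, with the value 0 when x < 0, y < 0 or
   x < y.  It differs from the generalised coefficient gchoose, which is nonzero for
   negative upper arguments. *)
definition binom :: "int \<Rightarrow> int \<Rightarrow> int" where
  "binom x y = (if x < 0 \<or> y < 0 \<or> x < y then 0 else int (nat x choose nat y))"

(* The number of r-element subsets of the H relays that contain i given relays, i.e. the
   number of users connected to all of them.  The subtractions are in int: K H r i = 0 for
   i > r, where truncated subtraction would give 1. *)
definition K :: "nat \<Rightarrow> nat \<Rightarrow> nat \<Rightarrow> int" where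
  "K H r i = binom (int H - int i) (int r - int i)"

(* Cache size needed for coded caching gain g by the asymmetric coded placement scheme. *)
definition M1 :: "nat \<Rightarrow> nat \<Rightarrow> nat \<Rightarrow> int \<Rightarrow> real" where
  "M1 H r N g =
     real N *
       (real_of_int (\<Sum>a = 1..r. binom (int r) (int a) * binom (K H r a - 1) (g - 2) * (-1) ^ (a - 1))
        / real_of_int (\<Sum>a = 1..r. binom (int r) (int a) * binom (K H r a) (g - 1) * (-1) ^ (a - 1)))"

(* Cache size needed for coded caching gain g by the MDS-based scheme. *)
definition M2 :: "nat \<Rightarrow> nat \<Rightarrow> nat \<Rightarrow> int \<Rightarrow> real" where
  "M2 H r N g = real N * (real_of_int (g - 1) / real_of_int (K H r 1))"

end

theory Submission
  imports Defs "HOL-Library.FuncSet"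
begin

text \<open>Fix the user \<open>U = {..<r}\<close>, put \<open>m = g - 2\<close>, and let \<open>u j\<close> be the number of \<open>m\<close>-sets of users
  other than \<open>U\<close> with a common relay among the first \<open>j\<close> relays of \<open>U\<close>. By inclusion-exclusion the
  numerator of \<open>M1\<close> is \<open>u r\<close>, and double counting with \<open>(g - 1) * (K choose (g - 1)) =
  K * ((K - 1) choose (g - 2))\<close> turns \<open>g - 1\<close> times its denominator into the sum of
  \<open>u |w \<inter> U|\<close> over all users \<open>w\<close>. Sizes of unions are concave in \<open>j\<close>, so \<open>u j / j\<close> is
  nonincreasing, and since the \<open>|w \<inter> U|\<close> sum to \<open>r * K1\<close>, that sum is at least \<open>K1 * u r\<close>.
  Equality forces \<open>u 2 = 2 * u 1\<close>, that is, no \<open>m\<close>-set shares two relays of \<open>U\<close>, which means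
  \<open>m \<ge> K2\<close>.\<close>

section \<open>Alternating binomial sums and inclusion-exclusion\<close>

text \<open>With the shift \<open>(E f) a = f (Suc a)\<close>, this is \<open>(1 - E)^n f\<close>
  evaluated at 0, an iterated difference of \<open>f\<close>.\<close>

definition alt_sum :: "(nat \<Rightarrow> int) \<Rightarrow> nat \<Rightarrow> int" where
  "alt_sum f n = (\<Sum>a\<le>n. (-1) ^ a * int (n choose a) * f a)"

lemma alt_sum_0 [simp]: "alt_sum f 0 = f 0"
  by (simp add: alt_sum_def)

lemma alt_sum_extend:
  assumes "n \<le> m"
  shows "alt_sum f n = (\<Sum>a\<le>m. (-1) ^ a * int (n choose a) * f a)"
  unfolding alt_sum_def using assms by (intro sum.mono_neutral_left) auto

text \<open>Pascal's rule, or in operator form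
  \<open>(1 - E)^(n+1) = (1 - E)^n - (1 - E)^n E\<close>.\<close>

lemma alt_sum_Suc: "alt_sum f (Suc n) = alt_sum f n - alt_sum (\<lambda>a. f (Suc a)) n"
proof -
  have "alt_sum f (Suc n) =
        f 0 + (\<Sum>a\<le>n. (-1) ^ Suc a * int (Suc n choose Suc a) * f (Suc a))"
    unfolding alt_sum_def by (subst sum.atMost_Suc_shift) simp
  also have "\<dots> = (f 0 + (\<Sum>a\<le>n. (-1) ^ Suc a * int (n choose Suc a) * f (Suc a)))
                  - alt_sum (\<lambda>a. f (Suc a)) n"
    by (simp add: alt_sum_def algebra_simps sum.distrib sum_negf sum_subtractf)
  also have "f 0 + (\<Sum>a\<le>n. (-1) ^ Suc a * int (n choose Suc a) * f (Suc a)) = alt_sum f n"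
    by (subst alt_sum_extend[of n "Suc n"], simp, subst sum.atMost_Suc_shift, simp)
  finally show ?thesis .
qed

text \<open>Splitting the subsets of \<open>insert x A\<close> by whether they contain
  \<open>x\<close> reproduces the recurrence \<open>alt_sum_Suc\<close>.\<close>

lemma sum_Pow_alternating:
  assumes "finite A"
  shows "(\<Sum>T\<in>Pow A. (-1) ^ card T * f (card T)) = alt_sum f (card A)"
  using assms
proof (induction A arbitrary: f rule: finite_induct)
  case (insert x A)
  have "(\<Sum>T\<in>insert x ` Pow A. (-1) ^ card T * f (card T))
      = (\<Sum>T\<in>Pow A. (-1) ^ card (insert x T) * f (card (insert x T)))"
    using insert.hyps by (subst sum.reindex) (auto simp: inj_on_def)
  also have "\<dots> = (\<Sum>T\<in>Pow A. - ((-1) ^ card T * f (Suc (card T))))"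
    using insert.hyps by (intro sum.cong refl) (auto simp: card_insert_if finite_subset)
  also have "\<dots> = - alt_sum (\<lambda>a. f (Suc a)) (card A)"
    using insert.IH[of "\<lambda>a. f (Suc a)"] by (simp add: sum_negf)
  finally have *: "(\<Sum>T\<in>insert x ` Pow A. (-1) ^ card T * f (card T))
      = - alt_sum (\<lambda>a. f (Suc a)) (card A)" .
  have "(\<Sum>T\<in>Pow (insert x A). (-1) ^ card T * f (card T))
      = (\<Sum>T\<in>Pow A. (-1) ^ card T * f (card T))
      + (\<Sum>T\<in>insert x ` Pow A. (-1) ^ card T * f (card T))"
    unfolding Pow_insert using insert.hyps by (intro sum.union_disjoint) auto
  with * insert show ?case
    by (simp add: alt_sum_Suc)
qed simp

lemma sum_Pow_sign_nonneg:
  assumes "finite A"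
  shows "0 \<le> (\<Sum>T\<in>Pow A. (-1) ^ card T :: int)"
proof -
  have "(\<Sum>T\<in>Pow A. (-1) ^ card T :: int) = alt_sum (\<lambda>_. 1) (card A)"
    using sum_Pow_alternating[OF assms, of "\<lambda>_. 1"] by simp
  also have "\<dots> = (if card A = 0 then 1 else 0)"
    using choose_alternating_sum[of "card A", where 'a = int] by (simp add: alt_sum_def)
  finally show ?thesis by simp
qed

text \<open>By inclusion-exclusion the sum counts the members of \<open>X\<close> that are related to no
  element of \<open>J\<close>.\<close>
lemma inclusion_exclusion_nonneg:
  assumes "finite J" "finite X"
  shows "0 \<le> (\<Sum>T\<in>Pow J. (-1) ^ card T * int (card {x \<in> X. \<forall>i\<in>T. R i x}))"
proof -
  have "(\<Sum>T\<in>Pow J. (-1) ^ card T * int (card {x \<in> X. \<forall>i\<in>T. R i x}))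
      = (\<Sum>T\<in>Pow J. \<Sum>x | x \<in> X \<and> (\<forall>i\<in>T. R i x). (-1) ^ card T)"
    by (simp add: mult.commute)
  \<comment> \<open>After the exchange, \<open>x\<close> contributes the sign sum over all subsets
    of the indices related to it: 1 if there are none, otherwise 0.\<close>
  also have "\<dots> = (\<Sum>x\<in>X. \<Sum>T | T \<in> Pow J \<and> (\<forall>i\<in>T. R i x). (-1) ^ card T)"
    using assms by (intro sum.swap_restrict) auto
  also have "\<dots> = (\<Sum>x\<in>X. \<Sum>T\<in>Pow {i \<in> J. R i x}. (-1) ^ card T)"
    by (intro sum.cong refl) auto
  also have "\<dots> \<ge> 0"
    using assms by (intro sum_nonneg sum_Pow_sign_nonneg) auto
  finally show ?thesis .
qed

section \<open>Counting users and sets of users\<close>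

definition users :: "nat \<Rightarrow> nat \<Rightarrow> nat set set" where
  "users H r = {w. w \<subseteq> {..<H} \<and> card w = r}"

lemma finite_users [simp]: "finite (users H r)"
  unfolding users_def by (rule finite_subset[of _ "Pow {..<H}"]) auto

text \<open>Removing \<open>T\<close> leaves an arbitrary choice of \<open>r - card T\<close> of the
  other relays. For \<open>card T > r\<close> the truncated difference would make the right-hand
  side 1, but no such user exists.\<close>

lemma card_users_superset:
  assumes "T \<subseteq> {..<H}" "card T \<le> r"
  shows "card {w \<in> users H r. T \<subseteq> w} = (H - card T) choose (r - card T)"
proof -
  have finT: "finite T"
    using assms(1) by (rule finite_subset) simp
  have "bij_betw (\<lambda>w. w \<union> T) {B. B \<subseteq> {..<H} - T \<and> card B = r - card T}
          {w \<in> users H r. T \<subseteq> w}"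
  proof (rule bij_betwI[where g = "\<lambda>w. w - T"])
    show "(\<lambda>w. w \<union> T) \<in> {B. B \<subseteq> {..<H} - T \<and> card B = r - card T}
            \<rightarrow> {w \<in> users H r. T \<subseteq> w}"
    proof
      fix B assume B: "B \<in> {B. B \<subseteq> {..<H} - T \<and> card B = r - card T}"
      then have "finite B"
        by (auto intro: finite_subset[of _ "{..<H}"])
      with B finT have "card (B \<union> T) = card B + card T"
        by (intro card_Un_disjoint) auto
      with B assms show "B \<union> T \<in> {w \<in> users H r. T \<subseteq> w}"
        by (auto simp: users_def)
    qed
    show "(\<lambda>w. w - T) \<in> {w \<in> users H r. T \<subseteq> w}
            \<rightarrow> {B. B \<subseteq> {..<H} - T \<and> card B = r - card T}"
      using finT by (auto simp: users_def card_Diff_subset)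
  qed auto
  then have "card {w \<in> users H r. T \<subseteq> w} = card {B. B \<subseteq> {..<H} - T \<and> card B = r - card T}"
    by (simp add: bij_betw_same_card)
  also have "\<dots> = (H - card T) choose (r - card T)"
    using assms(1) finT by (simp add: n_subsets card_Diff_subset)
  finally show ?thesis .
qed

text \<open>Double counting of the pairs of a user \<open>w\<close> and an \<open>a\<close>-set
  \<open>T\<close> contained in both \<open>w\<close> and \<open>{..<r}\<close>.\<close>

lemma sum_users_choose:
  assumes "r \<le> H" "a \<le> r"
  shows "(\<Sum>w\<in>users H r. card (w \<inter> {..<r}) choose a)
           = (r choose a) * ((H - a) choose (r - a))"
proof -
  have "(\<Sum>w\<in>users H r. card (w \<inter> {..<r}) choose a)
      = (\<Sum>w\<in>users H r. card {T \<in> {T. T \<subseteq> {..<r} \<and> card T = a}. T \<subseteq> w})"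
  proof (intro sum.cong refl)
    fix w assume "w \<in> users H r"
    have "card (w \<inter> {..<r}) choose a = card {T. T \<subseteq> w \<inter> {..<r} \<and> card T = a}"
      by (rule n_subsets[symmetric]) simp
    also have "{T. T \<subseteq> w \<inter> {..<r} \<and> card T = a} = {T \<in> {T. T \<subseteq> {..<r} \<and> card T = a}. T \<subseteq> w}"
      by auto
    finally show "card (w \<inter> {..<r}) choose a
        = card {T \<in> {T. T \<subseteq> {..<r} \<and> card T = a}. T \<subseteq> w}" .
  qed
  also have "\<dots> = ((H - a) choose (r - a)) * card {T. T \<subseteq> {..<r} \<and> card T = a}"
  proof (rule sum_multicount)
    show "\<forall>T\<in>{T. T \<subseteq> {..<r} \<and> card T = a}.
            card {w \<in> users H r. T \<subseteq> w} = (H - a) choose (r - a)"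
    proof
      fix T assume T: "T \<in> {T. T \<subseteq> {..<r} \<and> card T = a}"
      then have "T \<subseteq> {..<H}"
        using assms(1) by auto
      with T assms(2) show "card {w \<in> users H r. T \<subseteq> w} = (H - a) choose (r - a)"
        using card_users_superset[of T H r] by simp
    qed
  qed (auto intro: finite_subset[of _ "Pow {..<r}"])
  also have "card {T. T \<subseteq> {..<r} \<and> card T = a} = r choose a"
    by (simp add: n_subsets)
  finally show ?thesis by (simp add: mult.commute)
qed

text \<open>The number of \<open>m\<close>-sets of users, other than the user \<open>{..<r}\<close>, all connected to \<open>a\<close> given
  relays of that user.\<close>
definition others :: "nat \<Rightarrow> nat \<Rightarrow> nat \<Rightarrow> nat \<Rightarrow> int" where
  "others H r m a = int ((((H - a) choose (r - a)) - 1) choose m)"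

text \<open>Since \<open>T\<close> lies in \<open>{..<r}\<close>, the user \<open>{..<r}\<close> is
  itself connected to all of \<open>T\<close>; excluding it accounts for the \<open>- 1\<close> in
  \<open>others\<close>.\<close>

lemma others_eq_card:
  assumes "r \<le> H" "T \<subseteq> {..<r}"
  shows "others H r m (card T)
           = int (card {W. W \<subseteq> users H r - {{..<r}} \<and> card W = m \<and> (\<forall>w\<in>W. T \<subseteq> w)})"
proof -
  have "card T \<le> r"
    using card_mono[OF _ assms(2)] by simp
  moreover have "T \<subseteq> {..<H}"
    using assms by auto
  ultimately have *: "card {w \<in> users H r. T \<subseteq> w} = (H - card T) choose (r - card T)"
    by (intro card_users_superset)
  have "{..<r} \<in> {w \<in> users H r. T \<subseteq> w}"
    using assms by (auto simp: users_def)
  then have "card ({w \<in> users H r. T \<subseteq> w} - {{..<r}}) = ((H - card T) choose (r - card T)) - 1"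
    using * by simp
  then have "card {W. W \<subseteq> {w \<in> users H r. T \<subseteq> w} - {{..<r}} \<and> card W = m}
           = (((H - card T) choose (r - card T)) - 1) choose m"
    by (subst n_subsets) auto
  also have "{W. W \<subseteq> {w \<in> users H r. T \<subseteq> w} - {{..<r}} \<and> card W = m}
           = {W. W \<subseteq> users H r - {{..<r}} \<and> card W = m \<and> (\<forall>w\<in>W. T \<subseteq> w)}"
    by auto
  finally show ?thesis by (simp add: others_def)
qed

text \<open>The sum counts the \<open>m\<close>-sets of other users that share the first
  \<open>c\<close> relays but none of the next \<open>j\<close>. The case \<open>c = 1\<close>
  yields monotonicity of the union sizes, \<open>c = 2\<close> concavity.\<close>

lemma alt_sum_others_nonneg:
  assumes "r \<le> H" "c + j \<le> r"
  shows "0 \<le> alt_sum (\<lambda>a. others H r m (c + a)) j"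
proof -
  define J where "J = {c..<c + j}"
  define X where "X = {W. W \<subseteq> users H r - {{..<r}} \<and> card W = m \<and> (\<forall>w\<in>W. {..<c} \<subseteq> w)}"
  have fin: "finite J" "finite X" and J: "card J = j"
    by (auto simp: J_def X_def intro: finite_subset[of _ "Pow (users H r)"])
  have "alt_sum (\<lambda>a. others H r m (c + a)) j
      = (\<Sum>T\<in>Pow J. (-1) ^ card T * others H r m (c + card T))"
    using sum_Pow_alternating[OF fin(1), of "\<lambda>a. others H r m (c + a)"] J by simp
  also have "\<dots> = (\<Sum>T\<in>Pow J. (-1) ^ card T * int (card {W \<in> X. \<forall>i\<in>T. \<forall>w\<in>W. i \<in> w}))"
  proof (intro sum.cong refl)
    fix T assume T: "T \<in> Pow J"
    then have "finite T"
      using fin finite_subset by auto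
    then have "card ({..<c} \<union> T) = c + card T"
      using T by (subst card_Un_disjoint) (auto simp: J_def)
    moreover have "{..<c} \<union> T \<subseteq> {..<r}"
      using T assms by (auto simp: J_def)
    ultimately have "others H r m (c + card T)
        = int (card {W. W \<subseteq> users H r - {{..<r}} \<and> card W = m \<and> (\<forall>w\<in>W. {..<c} \<union> T \<subseteq> w)})"
      using others_eq_card[OF assms(1), of "{..<c} \<union> T" m] by simp
    also have "{W. W \<subseteq> users H r - {{..<r}} \<and> card W = m \<and> (\<forall>w\<in>W. {..<c} \<union> T \<subseteq> w)}
        = {W \<in> X. \<forall>i\<in>T. \<forall>w\<in>W. i \<in> w}"
      by (auto simp: X_def)
    finally show "(-1) ^ card T * others H r m (c + card T)
        = (-1) ^ card T * int (card {W \<in> X. \<forall>i\<in>T. \<forall>w\<in>W. i \<in> w})"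
      by simp
  qed
  also have "\<dots> \<ge> 0"
    using fin by (rule inclusion_exclusion_nonneg)
  finally show ?thesis .
qed

section \<open>Ratios of concave integer sequences\<close>

lemma concave_ratio:
  fixes u :: "nat \<Rightarrow> int"
  assumes "u 0 = 0"
    and concave: "\<And>j. Suc (Suc j) \<le> r \<Longrightarrow> u (Suc (Suc j)) - u (Suc j) \<le> u (Suc j) - u j"
    and "j \<le> r"
  shows "int j * u r \<le> int r * u j"
    and "0 < j \<Longrightarrow> j < r \<Longrightarrow> u 2 < 2 * u 1 \<Longrightarrow> int j * u r < int r * u j"
proof -
  \<comment> \<open>For \<open>k > 0\<close>, \<open>v k\<close> is \<open>k * (k + 1)\<close> times
    the increment of \<open>u k / k\<close>. Concavity makes \<open>v\<close> nonincreasing from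
    \<open>v 0 = 0\<close>, and \<open>u 2 < 2 * u 1\<close> says that
    \<open>v 1 < 0\<close>.\<close>
  define v where "v k = int k * u (Suc k) - int (Suc k) * u k" for k
  have v_Suc: "v (Suc k) \<le> v k" if "Suc (Suc k) \<le> r" for k
  proof -
    have "v (Suc k) - v k = int (Suc k) * (u (Suc (Suc k)) - u (Suc k) - (u (Suc k) - u k))"
      by (simp add: v_def algebra_simps)
    also have "\<dots> \<le> 0"
      using concave[OF that] by (intro mult_nonneg_nonpos) auto
    finally show ?thesis by simp
  qed
  have v_nonpos: "v k \<le> 0" if "Suc k \<le> r" for k
    using that
  proof (induction k)
    case 0
    then show ?case by (simp add: v_def assms(1))
  next
    case (Suc k)
    then show ?case using v_Suc[of k] by linarith
  qed
  have v_neg: "v k < 0" if "0 < k" "Suc k \<le> r" "u 2 < 2 * u 1" for k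
    using that
  proof (induction k)
    case (Suc k)
    show ?case
    proof (cases "k = 0")
      case True
      with Suc.prems show ?thesis by (simp add: v_def numeral_2_eq_2)
    next
      case False
      with Suc v_Suc[of k] show ?thesis by linarith
    qed
  qed simp
  have le: "int j * u k \<le> int k * u j" if "j \<le> k" "k \<le> r" for k
    using that
  proof (induction k rule: dec_induct)
    case (step k)
    show ?case
    proof (cases "k = 0")
      case True
      with step show ?thesis by (simp add: assms(1))
    next
      case False
      have "int k * (int j * u (Suc k)) = int (Suc k) * (int j * u k) + int j * v k"
        by (simp add: v_def algebra_simps)
      also have "\<dots> \<le> int (Suc k) * (int k * u j) + 0"
        using step v_nonpos[of k]
        by (intro add_mono mult_left_mono mult_nonneg_nonpos) auto
      also have "\<dots> = int k * (int (Suc k) * u j)"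
        by simp
      finally show ?thesis
        using False by (simp add: mult_le_cancel_left_pos)
    qed
  qed simp
  show "int j * u r \<le> int r * u j"
    using le[of r] assms(3) by simp
  show "int j * u r < int r * u j" if jr: "0 < j" "j < r" "u 2 < 2 * u 1"
  proof -
    obtain k where k: "r = Suc k"
      using jr by (cases r) auto
    \<comment> \<open>As \<open>j < r\<close>, at least one increment separates \<open>j\<close>
      from \<open>r\<close>; strictness is taken from the last one, \<open>v k\<close>.\<close>
    have "int k * (int j * u r) = int r * (int j * u k) + int j * v k"
      by (simp add: v_def k algebra_simps)
    also have "\<dots> < int r * (int k * u j)"
    proof -
      have "int r * (int j * u k) \<le> int r * (int k * u j)"
        using le[of k] jr k by (intro mult_left_mono) auto
      moreover have "int j * v k < 0"
        using v_neg[of k] jr k by (intro mult_pos_neg) auto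
      ultimately show ?thesis by linarith
    qed
    also have "\<dots> = int k * (int r * u j)"
      by simp
    finally show ?thesis
      using jr k by (simp add: mult_less_cancel_left_pos)
  qed
qed

section \<open>Sizes of unions and their sum over all users\<close>

text \<open>The size of a union of \<open>j\<close> sets, all of whose \<open>a\<close>-fold intersections have size \<open>f a\<close>.\<close>
definition union_size :: "(nat \<Rightarrow> int) \<Rightarrow> nat \<Rightarrow> int" where
  "union_size f j = f 0 - alt_sum f j"

text \<open>The \<open>a = 0\<close> term cancels. Terms with \<open>a > j\<close> vanish, so one
  range \<open>1..r\<close> serves all \<open>j\<close> and sums over \<open>j\<close> can be
  exchanged with it.\<close>

lemma union_size_eq_sum:
  assumes "j \<le> r"
  shows "union_size f j = (\<Sum>a = 1..r. (-1) ^ (a - 1) * int (j choose a) * f a)"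
proof -
  have "alt_sum f j = f 0 + (\<Sum>a = 1..r. (-1) ^ a * int (j choose a) * f a)"
    by (simp add: alt_sum_extend[OF assms] atMost_atLeast0 sum.atLeast_Suc_atMost)
  moreover have "(\<Sum>a = 1..r. (-1) ^ (a - 1) * int (j choose a) * f a)
      = (\<Sum>a = 1..r. - ((-1) ^ a * int (j choose a) * f a))"
  proof (intro sum.cong refl)
    fix a assume "a \<in> {1..r}"
    then show "(-1) ^ (a - 1) * int (j choose a) * f a = - ((-1) ^ a * int (j choose a) * f a)"
      by (cases a) auto
  qed
  ultimately show ?thesis
    by (simp add: union_size_def sum_negf)
qed

lemma union_size_0 [simp]: "union_size f 0 = 0"
  by (simp add: union_size_def)

lemma union_size_Suc: "union_size f (Suc j) = union_size f j + alt_sum (\<lambda>a. f (Suc a)) j"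
  by (simp add: union_size_def alt_sum_Suc)

text \<open>The second difference is minus the alternating sum shifted by 2.\<close>

lemma union_size_others_concave:
  assumes "r \<le> H" "Suc (Suc j) \<le> r"
  shows "union_size (others H r m) (Suc (Suc j)) - union_size (others H r m) (Suc j)
       \<le> union_size (others H r m) (Suc j) - union_size (others H r m) j"
  using alt_sum_others_nonneg[OF assms(1), of 2 j m] assms(2)
  by (simp add: union_size_Suc alt_sum_Suc)

text \<open>Increments are nonnegative, and the first union already has
  \<open>others H r m 1 > 0\<close> members.\<close>

lemma union_size_others_pos:
  assumes "r \<le> H" "0 < j" "j \<le> r" "m < (H - 1) choose (r - 1)"
  shows "0 < union_size (others H r m) j"
proof -
  have "others H r m 1 \<le> union_size (others H r m) (Suc k)" if "Suc k \<le> r" for k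
    using that
  proof (induction k)
    case (Suc k)
    then show ?case
      using alt_sum_others_nonneg[OF assms(1), of 1 "Suc k" m]
      by (subst union_size_Suc) simp
  qed (simp add: union_size_Suc)
  from this[of "j - 1"] assms(2,3) have "others H r m 1 \<le> union_size (others H r m) j"
    by simp
  moreover have "0 < others H r m 1"
    using assms(4) by (simp add: others_def zero_less_binomial_iff)
  ultimately show ?thesis by linarith
qed

lemma sum_union_size:
  assumes "r \<le> H"
  shows "(\<Sum>w\<in>users H r. union_size f (card (w \<inter> {..<r})))
       = (\<Sum>a = 1..r. (-1) ^ (a - 1) * int (r choose a) * int ((H - a) choose (r - a)) * f a)"
proof -
  have "card (w \<inter> {..<r}) \<le> r" for w
    using card_mono[of "{..<r}" "w \<inter> {..<r}"] by simp
  then have "(\<Sum>w\<in>users H r. union_size f (card (w \<inter> {..<r})))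
      = (\<Sum>w\<in>users H r. \<Sum>a = 1..r. (-1) ^ (a - 1) * int (card (w \<inter> {..<r}) choose a) * f a)"
    by (intro sum.cong refl union_size_eq_sum)
  also have "\<dots> = (\<Sum>a = 1..r. \<Sum>w\<in>users H r. (-1) ^ (a - 1) * int (card (w \<inter> {..<r}) choose a) * f a)"
    by (rule sum.swap)
  also have "\<dots> = (\<Sum>a = 1..r. (-1) ^ (a - 1) * int (\<Sum>w\<in>users H r. card (w \<inter> {..<r}) choose a) * f a)"
    by (simp add: sum_distrib_left sum_distrib_right)
  also have "\<dots> = (\<Sum>a = 1..r. (-1) ^ (a - 1) * int (r choose a) * int ((H - a) choose (r - a)) * f a)"
    using assms by (intro sum.cong refl) (simp add: sum_users_choose)
  finally show ?thesis .
qed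

text \<open>Multiplying by \<open>r\<close> lets \<open>concave_ratio\<close> act termwise with
  \<open>j = card (w \<inter> {..<r})\<close>. Strictness needs a user with
  \<open>0 < j < r\<close>, which \<open>2 \<le> r\<close> and \<open>r < H\<close> provide.\<close>

lemma sum_users_union_size_ge:
  fixes H r m :: nat
  assumes "r \<le> H" "0 < r"
  defines "u \<equiv> union_size (others H r m)"
  shows "int ((H - 1) choose (r - 1)) * u r \<le> (\<Sum>w\<in>users H r. u (card (w \<inter> {..<r})))"
    and "2 \<le> r \<Longrightarrow> r < H \<Longrightarrow>
         int ((H - 1) choose (r - 1)) * u r = (\<Sum>w\<in>users H r. u (card (w \<inter> {..<r})))
           \<longleftrightarrow> (H - 2) choose (r - 2) \<le> m"
proof -
  have le_r: "card (w \<inter> {..<r}) \<le> r" for w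
    using card_mono[of "{..<r}" "w \<inter> {..<r}"] by simp
  have lhs: "int r * (int ((H - 1) choose (r - 1)) * u r)
      = (\<Sum>w\<in>users H r. int (card (w \<inter> {..<r})) * u r)"
  proof -
    have "(\<Sum>w\<in>users H r. card (w \<inter> {..<r})) = r * ((H - 1) choose (r - 1))"
      using sum_users_choose[of r H 1] assms by simp
    then have "(\<Sum>w\<in>users H r. int (card (w \<inter> {..<r}))) = int r * int ((H - 1) choose (r - 1))"
      by (metis of_nat_mult of_nat_sum)
    then show ?thesis
      by (simp add: sum_distrib_right[symmetric] mult.assoc)
  qed
  have rhs: "int r * (\<Sum>w\<in>users H r. u (card (w \<inter> {..<r})))
      = (\<Sum>w\<in>users H r. int r * u (card (w \<inter> {..<r})))"
    by (simp add: sum_distrib_left)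
  have u0: "u 0 = 0"
    by (simp add: u_def)
  have conc: "u (Suc (Suc j)) - u (Suc j) \<le> u (Suc j) - u j" if "Suc (Suc j) \<le> r" for j
    using union_size_others_concave[OF assms(1) that] by (simp add: u_def)
  note ratio = concave_ratio[of u r, OF u0 conc]
  have "int r * (int ((H - 1) choose (r - 1)) * u r) \<le> int r * (\<Sum>w\<in>users H r. u (card (w \<inter> {..<r})))"
    unfolding lhs rhs by (intro sum_mono ratio(1) le_r)
  then show "int ((H - 1) choose (r - 1)) * u r \<le> (\<Sum>w\<in>users H r. u (card (w \<inter> {..<r})))"
    using assms(2) by (simp add: mult_le_cancel_left_pos)
  assume r: "2 \<le> r" "r < H"
  have "int ((H - 1) choose (r - 1)) * u r < (\<Sum>w\<in>users H r. u (card (w \<inter> {..<r})))"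
    if m: "m < (H - 2) choose (r - 2)"
  proof -
    have "0 < others H r m 2"
      using m by (simp add: others_def zero_less_binomial_iff)
    moreover have "u 2 = 2 * u 1 - others H r m 2"
      by (simp add: u_def numeral_2_eq_2 union_size_Suc alt_sum_Suc)
    ultimately have u2: "u 2 < 2 * u 1"
      by linarith
    \<comment> \<open>The witness for strictness is \<open>{..<r}\<close> shifted by one relay; it
      shares \<open>r - 1\<close> relays with \<open>{..<r}\<close>.\<close>
    have "{1..r} \<inter> {..<r} = {1..<r}"
      by auto
    then have "card ({1..r} \<inter> {..<r}) = r - 1"
      by simp
    then have "int (card ({1..r} \<inter> {..<r})) * u r < int r * u (card ({1..r} \<inter> {..<r}))"
      using r u2 by (intro ratio(2)) auto
    moreover have "{1..r} \<in> users H r"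
      using r by (auto simp: users_def)
    ultimately have "(\<Sum>w\<in>users H r. int (card (w \<inter> {..<r})) * u r)
        < (\<Sum>w\<in>users H r. int r * u (card (w \<inter> {..<r})))"
      by (intro sum_strict_mono_ex1 ballI ratio(1) le_r) auto
    then have "int r * (int ((H - 1) choose (r - 1)) * u r)
        < int r * (\<Sum>w\<in>users H r. u (card (w \<inter> {..<r})))"
      by (simp only: lhs rhs)
    then show ?thesis
      using assms(2) by (simp only: mult_less_cancel_left_pos of_nat_0_less_iff)
  qed
  moreover have "int ((H - 1) choose (r - 1)) * u r = (\<Sum>w\<in>users H r. u (card (w \<inter> {..<r})))"
    if m: "(H - 2) choose (r - 2) \<le> m"
  proof -
    \<comment> \<open>Too few users share two or more relays, so only \<open>a = 1\<close> survives
      on both sides, and there the weight is the common factor.\<close>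
    have f0: "others H r m a = 0" if "2 \<le> a" "a \<le> r" for a
    proof -
      have "card {w \<in> users H r. {..<a} \<subseteq> w} \<le> card {w \<in> users H r. {..<2} \<subseteq> w}"
        using that by (intro card_mono) auto
      then have "(H - a) choose (r - a) \<le> (H - 2) choose (r - 2)"
        using card_users_superset[of "{..<a}" H r] card_users_superset[of "{..<2}" H r] that assms(1)
        by simp
      moreover have "0 < (H - 2) choose (r - 2)"
        using assms(1) by (simp add: zero_less_binomial_iff)
      ultimately have "((H - a) choose (r - a)) - 1 < m"
        using m by linarith
      then show ?thesis
        by (simp add: others_def)
    qed
    have "(\<Sum>w\<in>users H r. u (card (w \<inter> {..<r})))
       = (\<Sum>a \<in> {1..r}. (-1) ^ (a - 1) * int (r choose a) * int ((H - a) choose (r - a)) * others H r m a)"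
      unfolding u_def by (rule sum_union_size[OF assms(1)])
    also have "\<dots> = (\<Sum>a \<in> {1..r}. int ((H - 1) choose (r - 1)) * ((-1) ^ (a - 1) * int (r choose a) * others H r m a))"
    proof (intro sum.cong refl)
      fix a assume "a \<in> {1..r}"
      then show "(-1) ^ (a - 1) * int (r choose a) * int ((H - a) choose (r - a)) * others H r m a
          = int ((H - 1) choose (r - 1)) * ((-1) ^ (a - 1) * int (r choose a) * others H r m a)"
        using f0[of a] by (cases "a = 1") auto
    qed
    also have "\<dots> = int ((H - 1) choose (r - 1)) * u r"
      unfolding u_def by (simp add: union_size_eq_sum[of r r] sum_distrib_left)
    finally show ?thesis by simp
  qed
  ultimately show "int ((H - 1) choose (r - 1)) * u r = (\<Sum>w\<in>users H r. u (card (w \<inter> {..<r})))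
      \<longleftrightarrow> (H - 2) choose (r - 2) \<le> m"
    by (cases "m < (H - 2) choose (r - 2)") auto
qed

section \<open>Translation to the cache sizes\<close>

lemma binom_of_nat: "binom (int n) (int k) = int (n choose k)"
  by (simp add: binom_def)

lemma K_eq:
  assumes "r \<le> H" "a \<le> r"
  shows "K H r a = int ((H - a) choose (r - a))"
  using assms binom_of_nat[of "H - a" "r - a"] by (simp add: K_def of_nat_diff)

text \<open>At \<open>g = 1\<close> both cache sizes are 0, since \<open>binom\<close> vanishes at
  the lower argument -1. Equality thus holds although \<open>g < K H r 2 + 2\<close>, hence the
  separate disjunct.\<close>

theorem corollary1:
  fixes H r N :: nat and g :: int
  assumes "0 < H" and "0 < r" and "0 < N" and "r \<le> H"
    and "1 \<le> g" and "g \<le> K H r 1"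
  shows "M1 H r N g \<le> M2 H r N g \<and>
         (M1 H r N g = M2 H r N g \<longleftrightarrow> g = 1 \<or> g \<ge> K H r 2 + 2)"
proof (cases "g = 1")
  case True
  then show ?thesis by (simp add: M1_def M2_def binom_def)
next
  case False
  define m where "m = nat (g - 2)"
  have g: "g - 2 = int m" "g - 1 = int (Suc m)"
    using False assms(5) by (auto simp: m_def)
  define k where "k a = (H - a) choose (r - a)" for a
  have K1: "K H r 1 = int (k 1)"
    using assms by (simp add: K_eq k_def)
  then have m_less: "Suc m < k 1"
    using assms(6) g by simp
  \<comment> \<open>Either equality would give \<open>k 1 = 1\<close>, leaving only
    \<open>g = 1\<close>.\<close>
  have "r \<noteq> 1" "r \<noteq> H"
    using m_less by (auto simp: k_def)
  then have r: "2 \<le> r" "r < H"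
    using assms by auto
  have k_pos: "0 < k a" for a
    using assms by (simp add: k_def zero_less_binomial_iff)
  define u where "u = union_size (others H r m)"
  define S where "S = (\<Sum>w\<in>users H r. u (card (w \<inter> {..<r})))"
  define d where "d = (\<Sum>a = 1..r. binom (int r) (int a) * binom (K H r a) (g - 1) * (-1) ^ (a - 1))"
  have n: "(\<Sum>a = 1..r. binom (int r) (int a) * binom (K H r a - 1) (g - 2) * (-1) ^ (a - 1)) = u r"
    unfolding u_def union_size_eq_sum[OF order_refl]
  proof (intro sum.cong refl)
    fix a assume "a \<in> {1..r}"
    \<comment> \<open>Positivity of \<open>k a\<close> makes the truncated subtraction in
      \<open>others\<close> agree with the integer one in \<open>M1\<close>.\<close>
    then have "K H r a - 1 = int (k a - 1)"
      using k_pos[of a] K_eq[OF assms(4), of a] by (simp add: k_def[symmetric] of_nat_diff)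
    then show "binom (int r) (int a) * binom (K H r a - 1) (g - 2) * (-1) ^ (a - 1)
        = (-1) ^ (a - 1) * int (r choose a) * others H r m a"
      by (simp only: g binom_of_nat others_def k_def) simp
  qed
  have d: "int (Suc m) * d = S"
    unfolding d_def S_def u_def sum_union_size[OF assms(4)] sum_distrib_left
  proof (intro sum.cong refl)
    fix a assume a: "a \<in> {1..r}"
    have "Suc m * (k a choose Suc m) = k a * ((k a - 1) choose m)"
      using Suc_times_binomial_eq[of "k a - 1" m] k_pos[of a] by (simp add: mult.commute)
    then have "int (Suc m) * int (k a choose Suc m) = int (k a) * others H r m a"
      unfolding others_def k_def[symmetric] by (metis of_nat_mult)
    moreover have "binom (K H r a) (g - 1) = int (k a choose Suc m)"
      using a assms(4) by (simp only: g K_eq binom_of_nat k_def atLeastAtMost_iff)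
    ultimately show "int (Suc m) * (binom (int r) (int a) * binom (K H r a) (g - 1) * (-1) ^ (a - 1))
        = (-1) ^ (a - 1) * int (r choose a) * int ((H - a) choose (r - a)) * others H r m a"
      by (simp add: binom_of_nat k_def ac_simps)
  qed
  have le: "int (k 1) * u r \<le> S"
    unfolding k_def S_def u_def using assms by (intro sum_users_union_size_ge(1)) auto
  have eq: "int (k 1) * u r = S \<longleftrightarrow> k 2 \<le> m"
    unfolding k_def S_def u_def using assms r by (intro sum_users_union_size_ge(2)) auto
  \<comment> \<open>The main inequality itself gives the sign of the denominator,
    \<open>(m + 1) * d = S \<ge> k 1 * u r > 0\<close>, which permits cross-multiplication.\<close>
  have "0 < u r"
    unfolding u_def using m_less assms by (intro union_size_others_pos) (auto simp: k_def)
  then have "0 < int (k 1) * u r"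
    using k_pos[of 1] by (intro mult_pos_pos) auto
  with le d have "0 < int (Suc m) * d"
    by linarith
  then have d_pos: "0 < d"
    by (simp add: zero_less_mult_iff)
  have M: "M1 H r N g = real N * (real_of_int (u r) / real_of_int d)"
          "M2 H r N g = real N * (real (Suc m) / real (k 1))"
    unfolding M1_def M2_def n d_def[symmetric] by (simp_all only: g K1 of_int_of_nat_eq)
  have "M1 H r N g \<le> M2 H r N g \<longleftrightarrow> real_of_int (u r) / real_of_int d \<le> real (Suc m) / real (k 1)"
    unfolding M using assms(3) by (intro mult_le_cancel_left_pos) simp
  also have "\<dots> \<longleftrightarrow> real_of_int (int (k 1) * u r) \<le> real_of_int (int (Suc m) * d)"
    using d_pos k_pos[of 1] by (simp add: divide_le_eq le_divide_eq mult.commute)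
  also have "\<dots> \<longleftrightarrow> int (k 1) * u r \<le> S"
    unfolding d of_int_le_iff ..
  finally have "M1 H r N g \<le> M2 H r N g"
    using le by simp
  moreover have "M1 H r N g = M2 H r N g \<longleftrightarrow> g = 1 \<or> g \<ge> K H r 2 + 2"
  proof -
    have "M1 H r N g = M2 H r N g \<longleftrightarrow> real_of_int (u r) / real_of_int d = real (Suc m) / real (k 1)"
      unfolding M using assms(3) by (simp only: mult_cancel_left) simp
    also have "\<dots> \<longleftrightarrow> real_of_int (int (k 1) * u r) = real_of_int (int (Suc m) * d)"
      using d_pos k_pos[of 1] by (simp add: frac_eq_eq mult.commute)
    also have "\<dots> \<longleftrightarrow> k 2 \<le> m"
      unfolding d of_int_eq_iff by (rule eq)
    also have "\<dots> \<longleftrightarrow> g \<ge> K H r 2 + 2"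
      using K_eq[OF assms(4) r(1)] g by (simp add: k_def)
    finally show ?thesis
      using False by simp
  qed
  ultimately show ?thesis ..
qed

end
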